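(* Let $\sigma_1,\sigma_2$ be RAM memory states and let $o$ be a basic RAM operation. If $\sigma_1 \restriction \mathrm{ireg}(o) = \sigma_2 \restriction \mathrm{ireg}(o)$, then $o(\sigma_1) \restriction \mathrm{oreg}(o) = o(\sigma_2) \restriction \mathrm{oreg}(o)$.
   Context: Let $\{0,1\}^*$ denote the set of finite bit strings and $\varepsilon$ the empty bit string. A RAM memory state is a function $\sigma:\mathbb{N}\to\{0,1\}^*$ such that there exists $i\in\mathbb{N}$ with $\sigma(i+j)=\varepsilon$ for all $j\in\mathbb{N}$; let $\mathit{MS}$ be the set of all RAM memory states. For a function $o:\mathit{MS}\to\mathit{MS}$ define the output region $\mathrm{oreg}(o)=\{i\in\mathbb{N} : \exists \sigma\in\mathit{MS}\ (\sigma(i)\neq o(\sigma)(i))\}$ and the input region $\mathrm{ireg}(o)=\{i\in\mathbb{N} : \exists \sigma_1,\sigma_2\in\mathit{MS}\ (\forall j\in\mathbb{N}\setminus\{i\}\ \sigma_1(j)=\sigma_2(j)) \wedge \exists j\in\mathrm{oreg}(o)\ (o(\sigma_1)(j)\neq o(\sigma_2)(j))\}$. A basic RAM operation is a function $o:\mathit{MS}\to\mathit{MS}$ such that $\mathrm{ireg}(o)$ is finite and $|\mathrm{oreg}(o)|\le 1$. For a function $f$ and $D\subseteq\mathrm{dom}(f)$, $f\restriction D$ denotes the restriction of $f$ to $D$. *)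

theory Defs
  imports Main "HOL-Library.FuncSet"
begin

type_synonym bit_string = "bool list"

type_synonym memory = "nat \<Rightarrow> bit_string"

definition MS :: "memory set" where
  "MS = {\<sigma>. \<exists>i. \<forall>j. \<sigma> (i + j) = []}"

(* A function MS -> MS is encoded as a total HOL function that maps MS into MS;
   its values outside MS are arbitrary. All quantifiers over states below are
   therefore bounded by MS, so these values are irrelevant. *)

definition oreg :: "(memory \<Rightarrow> memory) \<Rightarrow> nat set" where
  "oreg f = {i. \<exists>\<sigma>\<in>MS. \<sigma> i \<noteq> f \<sigma> i}"

definition ireg :: "(memory \<Rightarrow> memory) \<Rightarrow> nat set" where
  "ireg f = {i. \<exists>\<sigma>\<^sub>1\<in>MS. \<exists>\<sigma>\<^sub>2\<in>MS.
     (\<forall>j\<in>UNIV - {i}. \<sigma>\<^sub>1 j = \<sigma>\<^sub>2 j) \<and> (\<exists>j\<in>oreg f. f \<sigma>\<^sub>1 j \<noteq> f \<sigma>\<^sub>2 j)}"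

(* Finiteness of oreg is explicit because card is 0 on infinite sets. *)
definition basic_RAM_operation :: "(memory \<Rightarrow> memory) \<Rightarrow> bool" where
  "basic_RAM_operation f \<longleftrightarrow>
     f \<in> MS \<rightarrow> MS \<and> finite (ireg f) \<and> finite (oreg f) \<and> card (oreg f) \<le> 1"

end

theory Submission
  imports Defs
begin

text \<open>Two memory states differ in finitely many registers only, so one can be turned into the other by
  changing one register at a time. If the states agree on the input region, every register changed
  lies outside of it, and hence no step affects the result on the output region.\<close>

text \<open>A set of naturals is finite iff it is bounded. In the finite-support form, closure of
  \<open>MS\<close> under a single update and finiteness of the difference of two states reduce to
  \<open>insert\<close> and union of finite sets.\<close>

lemma MS_iff_finite_support: "\<sigma> \<in> MS \<longleftrightarrow> finite {i. \<sigma> i \<noteq> []}"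
proof
  assume "\<sigma> \<in> MS"
  then obtain n where n: "\<And>j. \<sigma> (n + j) = []"
    unfolding MS_def by blast
  have "{i. \<sigma> i \<noteq> []} \<subseteq> {..<n}"
  proof
    fix i assume "i \<in> {i. \<sigma> i \<noteq> []}"
    then show "i \<in> {..<n}"
      using n[of "i - n"] by (cases "i < n") auto
  qed
  then show "finite {i. \<sigma> i \<noteq> []}"
    by (rule finite_subset) simp
next
  assume "finite {i. \<sigma> i \<noteq> []}"
  then obtain n where "\<forall>i\<in>{i. \<sigma> i \<noteq> []}. i < n"
    unfolding finite_nat_set_iff_bounded by blast
  then have "\<forall>j. \<sigma> (n + j) = []"
    by fastforce
  then show "\<sigma> \<in> MS"
    unfolding MS_def by blast
qed

lemma MS_fun_upd:
  assumes "\<sigma> \<in> MS"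
  shows "\<sigma>(i := b) \<in> MS"
proof -
  have "{j. (\<sigma>(i := b)) j \<noteq> []} \<subseteq> insert i {j. \<sigma> j \<noteq> []}"
    by auto
  with assms show ?thesis
    unfolding MS_iff_finite_support by (meson finite_insert finite_subset)
qed

lemma finite_MS_differences:
  assumes "\<sigma> \<in> MS" and "\<tau> \<in> MS"
  shows "finite {i. \<sigma> i \<noteq> \<tau> i}"
proof (rule finite_subset)
  show "{i. \<sigma> i \<noteq> \<tau> i} \<subseteq> {i. \<sigma> i \<noteq> []} \<union> {i. \<tau> i \<noteq> []}"
    by auto
  show "finite ({i. \<sigma> i \<noteq> []} \<union> {i. \<tau> i \<noteq> []})"
    using assms by (simp add: MS_iff_finite_support)
qed

text \<open>Otherwise \<open>\<sigma>(i := b)\<close> and \<open>\<sigma>\<close>, which differ at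
  most at \<open>i\<close>, would be the two states witnessing
  \<open>i \<in> ireg f\<close>.\<close>

lemma oreg_unaffected_by_fun_upd:
  assumes "\<sigma> \<in> MS" and "i \<notin> ireg f" and "j \<in> oreg f"
  shows "f (\<sigma>(i := b)) j = f \<sigma> j"
proof (rule ccontr)
  assume "f (\<sigma>(i := b)) j \<noteq> f \<sigma> j"
  moreover have "\<forall>k\<in>UNIV - {i}. (\<sigma>(i := b)) k = \<sigma> k"
    by simp
  ultimately have "i \<in> ireg f"
    unfolding ireg_def using assms(1,3) MS_fun_upd[OF assms(1)] by blast
  with assms(2) show False by contradiction
qed

text \<open>Induction on \<open>D\<close>, a finite set containing all registers where the states
  differ. The state \<open>\<sigma>\<close> must vary: copying \<open>\<tau> d\<close> into register
  \<open>d\<close> gives a state that agrees with \<open>\<tau>\<close> off the smaller set, so the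
  induction hypothesis applies to it.\<close>

lemma oreg_unaffected_off_ireg:
  assumes "finite D" and "D \<inter> ireg f = {}" and "j \<in> oreg f"
    and "\<sigma> \<in> MS" and "\<And>i. i \<notin> D \<Longrightarrow> \<sigma> i = \<tau> i"
  shows "f \<sigma> j = f \<tau> j"
  using assms
proof (induction D arbitrary: \<sigma> rule: finite_induct)
  case empty
  then have "\<sigma> = \<tau>" by auto
  then show ?case by simp
next
  case (insert d D)
  have "f (\<sigma>(d := \<tau> d)) j = f \<tau> j"
    using insert.prems by (intro insert.IH MS_fun_upd) auto
  moreover have "f (\<sigma>(d := \<tau> d)) j = f \<sigma> j"
    using insert.prems by (intro oreg_unaffected_by_fun_upd) auto
  ultimately show ?case by simp
qed

theorem theorem5:
  fixes \<sigma>\<^sub>1 \<sigma>\<^sub>2 :: memory and f :: "memory \<Rightarrow> memory"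
  assumes "\<sigma>\<^sub>1 \<in> MS" and "\<sigma>\<^sub>2 \<in> MS"
    and "basic_RAM_operation f"
    and "restrict \<sigma>\<^sub>1 (ireg f) = restrict \<sigma>\<^sub>2 (ireg f)"
  shows "restrict (f \<sigma>\<^sub>1) (oreg f) = restrict (f \<sigma>\<^sub>2) (oreg f)"
proof (rule restrict_ext)
  fix j assume j: "j \<in> oreg f"
  have "\<sigma>\<^sub>1 i = \<sigma>\<^sub>2 i" if "i \<in> ireg f" for i
    using assms(4) that by (metis restrict_apply')
  then have "{i. \<sigma>\<^sub>1 i \<noteq> \<sigma>\<^sub>2 i} \<inter> ireg f = {}"
    by blast
  \<comment> \<open>Here \<open>D\<close> is exactly the set of registers where the two states
    differ, so agreement outside \<open>D\<close> is immediate.\<close>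
  with finite_MS_differences[OF assms(1,2)] show "f \<sigma>\<^sub>1 j = f \<sigma>\<^sub>2 j"
    using j assms(1) by (rule oreg_unaffected_off_ireg) simp
qed

end
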